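(* Let $\beta>0$. For sequences $(\sigma_k)_{k\ge1}$ and $(p_k)_{k\ge1}$ of real numbers, with $\sigma_k>0$ and $p_k>0$, set $$r_k=\frac{k^{-\beta-1/2}}{\sigma_k},\qquad z_k=\frac{r_k^{p_k}}{p_k},\qquad N_\beta=\lfloor n^{\frac1{2\beta+1}}\rfloor ,$$ and consider the following conditions: (o) $0<p_k\le 1$ for all $k\ge1$; (a) for $n$ large enough, $r_k^{p_k}\ge8$ for all $k>N_\beta$; (b) there exists a constant $\eta>1$ such that $\sum_{k\ge1}\exp\{-z_k/4\}<+\infty$ and $\sum_{k\le N_\beta}z_k\lesssim N_\beta\log^\eta n$. Conditions (o), (a) and (b) are met for each of the following choices of sequences $(p_k)$, $(\sigma_k)$: 1. (Polynomial decay of the scaling) for $\alpha>\beta>0$: $p_1=p_2=1$, $\sigma_k=k^{-1/2-\alpha}$, and $p_k=(\log k)^{-1}\log\log k$ for all $k\ge3$; 2. (Faster than polynomial decay) for $\gamma>0$ and $c>2.1>\log 8$: $p_1=p_2=1$, $\sigma_k=\exp(-\log^{1+\gamma}k)$, and $p_k=c(\log k)^{-(1+\gamma)}$ for all $k\ge3$.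
   Context: $\log^{a}k$ denotes $(\log k)^a$. $a_n\lesssim b_n$ means $a_n\le Cb_n$ for a constant $C>0$ independent of $n$. Conditions (o), (a), (b) are the conditions on the prior in a posterior contraction theorem for the following setting. One observes $X_k=f_k+\xi_k/\sqrt n$, $k\ge1$, with $\xi_k$ i.i.d. $N(0,1)$. The prior $\Pi$ on $f=(f_k)_{k\ge1}$ is given by $f_k=\sigma_k\zeta_k$ with $\zeta_k$ independent of density proportional to $\exp\{-|t|^{p_k}/p_k\}$. The true $f_0$ satisfies $\max_{k\ge1}|f_{0,k}|k^{\beta+1/2}\le L$ for some $L\ge1$. For $\rho\in(0,1)$, the $\rho$-posterior $\Pi_\rho[\cdot\mid X]$ is obtained by raising the likelihood to the power $\rho$ in Bayes' formula. The theorem states that under these conditions, for any $\rho\in(0,1)$, there is a constant $\eta'>2\eta$ such that $E_{f_0}\Pi_\rho[\|f-f_0\|_2\le n^{-\beta/(2\beta+1)}\log^{\eta'}n\mid X]\to1$ as $n\to\infty$, where $\|f-f_0\|_2^2=\sum_k(f_k-f_{0,k})^2$.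
   Formalization: Choice 2 fails (o) as printed (γ=1, c=3 gives p_3≈2.49>1). Proved instead: (a), (b) for all γ>0, c>2.1; p_k≤1 for large k; (o) holds exactly when c≤(log 3)^{1+γ}; and (o), (a), (b) all hold for min(1,p_k). *)

theory Defs
  imports Complex_Main
begin

text \<open>
  Sequences indexed by \<open>k \<ge> 1\<close> are functions on \<^typ>\<open>nat\<close>; the value at index 0 is never used.
\<close>

definition pos_seqs :: "(nat \<Rightarrow> real) \<Rightarrow> (nat \<Rightarrow> real) \<Rightarrow> bool" where
  "pos_seqs \<sigma> p \<longleftrightarrow> (\<forall>k\<ge>1. 0 < \<sigma> k \<and> 0 < p k)"

definition r_seq :: "real \<Rightarrow> (nat \<Rightarrow> real) \<Rightarrow> nat \<Rightarrow> real" where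
  "r_seq \<beta> \<sigma> k = real k powr (- \<beta> - 1/2) / \<sigma> k"

definition z_seq :: "real \<Rightarrow> (nat \<Rightarrow> real) \<Rightarrow> (nat \<Rightarrow> real) \<Rightarrow> nat \<Rightarrow> real" where
  "z_seq \<beta> \<sigma> p k = r_seq \<beta> \<sigma> k powr p k / p k"

definition N_cut :: "real \<Rightarrow> nat \<Rightarrow> nat" where
  "N_cut \<beta> n = nat \<lfloor>real n powr (1 / (2 * \<beta> + 1))\<rfloor>"

definition cond_o :: "(nat \<Rightarrow> real) \<Rightarrow> bool" where
  "cond_o p \<longleftrightarrow> (\<forall>k\<ge>1. 0 < p k \<and> p k \<le> 1)"

definition cond_a :: "real \<Rightarrow> (nat \<Rightarrow> real) \<Rightarrow> (nat \<Rightarrow> real) \<Rightarrow> bool" where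
  "cond_a \<beta> \<sigma> p \<longleftrightarrow>
     (\<forall>\<^sub>F n in sequentially. \<forall>k>N_cut \<beta> n. r_seq \<beta> \<sigma> k powr p k \<ge> 8)"

text \<open>
  The bound in \<open>cond_b\<close> holds with one constant for all \<open>n \<ge> 2\<close>; \<open>n = 1\<close> is left out
  because there the right-hand side is 0.
\<close>

definition cond_b :: "real \<Rightarrow> (nat \<Rightarrow> real) \<Rightarrow> (nat \<Rightarrow> real) \<Rightarrow> bool" where
  "cond_b \<beta> \<sigma> p \<longleftrightarrow>
     (\<exists>\<eta>>1. summable (\<lambda>k. exp (- z_seq \<beta> \<sigma> p (Suc k) / 4)) \<and>
        (\<exists>C>0. \<forall>n\<ge>2. (\<Sum>k=1..N_cut \<beta> n. z_seq \<beta> \<sigma> p k)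
                         \<le> C * (real (N_cut \<beta> n) * ln (real n) powr \<eta>)))"

definition sigma_poly :: "real \<Rightarrow> nat \<Rightarrow> real" where
  "sigma_poly \<alpha> k = real k powr (- 1/2 - \<alpha>)"

definition p_poly :: "nat \<Rightarrow> real" where
  "p_poly k = (if k < 3 then 1 else ln (ln (real k)) / ln (real k))"

definition sigma_fast :: "real \<Rightarrow> nat \<Rightarrow> real" where
  "sigma_fast \<gamma> k = exp (- (ln (real k) powr (1 + \<gamma>)))"

definition p_fast :: "real \<Rightarrow> real \<Rightarrow> nat \<Rightarrow> real" where
  "p_fast \<gamma> c k = (if k < 3 then 1 else c * ln (real k) powr (- (1 + \<gamma>)))"

text \<open>
  \<open>p_fast\<close> can exceed 1 at finitely many indices (for instance at \<open>k = 3\<close> when \<open>\<gamma> = 1\<close> and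
  \<open>c = 3\<close>), so it need not satisfy \<open>cond_o\<close>. Capping it at 1 changes only those values; it
  changes nothing when \<open>p_fast\<close> already satisfies \<open>cond_o\<close>.
\<close>

definition p_fast_capped :: "real \<Rightarrow> real \<Rightarrow> nat \<Rightarrow> real" where
  "p_fast_capped \<gamma> c k = min 1 (p_fast \<gamma> c k)"

end

theory Submission
  imports Defs "HOL-Analysis.Analysis" "HOL-Real_Asymp.Real_Asymp"
begin

text \<open>
  With \<open>L = ln k\<close>, for \<open>k \<ge> 3\<close> the power \<open>r\<^sub>k powr p\<^sub>k\<close> equals \<open>L powr (\<alpha> - \<beta>)\<close> in the polynomial
  case, and in the fast case \<open>exp (c - c * (\<beta> + 1/2) * L powr - \<gamma>)\<close>, which tends to \<open>exp c > 8\<close>.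
  In both cases \<open>z\<^sub>k\<close> grows faster than \<open>L\<close>, so that eventually \<open>exp (- z\<^sub>k / 4) \<le> 1 / k^2\<close>, and
  is at most a constant times \<open>L powr \<eta>\<close> with \<open>\<eta> = 1 + \<alpha> - \<beta>\<close> or \<open>\<eta> = 1 + \<gamma>\<close>; as
  \<open>N\<^sub>\<beta> \<le> n\<close>, summing the latter bound gives the second half of (b).
\<close>

section \<open>Logarithms and the cutoff \<open>N_cut\<close>\<close>

lemma ln_gt_1: "ln (real k) > 1" if "k \<ge> 3"
proof -
  have "ln 3 \<le> ln (real k)" using that by simp
  with ln3_gt_1 show ?thesis by linarith
qed

text \<open>The exponent is at most 1. This lets \<open>ln k\<close> be bounded by
  \<open>ln n\<close> for every index \<open>k\<close> in the sum of (b).\<close>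

lemma N_cut_le:
  assumes "\<beta> > 0" "n \<ge> 1"
  shows "N_cut \<beta> n \<le> n"
proof -
  have "real n powr (1 / (2 * \<beta> + 1)) \<le> real n powr 1"
    using assms by (intro powr_mono) auto
  then show ?thesis
    using assms unfolding N_cut_def by simp linarith
qed

lemma filterlim_N_cut:
  assumes "\<beta> > 0"
  shows "filterlim (N_cut \<beta>) at_top sequentially"
proof -
  have "1 / (2 * \<beta> + 1) > 0" using assms by simp
  then have "filterlim (\<lambda>n. real n powr (1 / (2 * \<beta> + 1))) at_top sequentially"
    by real_asymp
  then show ?thesis
    unfolding N_cut_def
    by (intro filterlim_compose[OF filterlim_nat_sequentially]
          filterlim_compose[OF filterlim_floor_sequentially])
qed

section \<open>Reduction of (a) and (b) to eventual bounds\<close>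

lemma cond_aI:
  assumes "\<beta> > 0" and "\<forall>\<^sub>F k in sequentially. r_seq \<beta> \<sigma> k powr p k \<ge> 8"
  shows "cond_a \<beta> \<sigma> p"
proof -
  obtain K where K: "\<And>k. k \<ge> K \<Longrightarrow> r_seq \<beta> \<sigma> k powr p k \<ge> 8"
    using assms(2) by (auto simp: eventually_sequentially)
  \<comment> \<open>The threshold \<open>K\<close> is fixed while the cutoff tends to infinity, so
    for large \<open>n\<close> all indices beyond the cutoff lie beyond \<open>K\<close>.\<close>
  have "\<forall>\<^sub>F n in sequentially. N_cut \<beta> n \<ge> K"
    using filterlim_N_cut[OF assms(1)] by (simp add: filterlim_at_top)
  then show ?thesis
    unfolding cond_a_def by eventually_elim (auto intro: K)
qed

text \<open>The factor 8 gives \<open>z / 4 \<ge> 2 * ln k\<close>, hence comparison with the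
  convergent series of \<open>1 / k^2\<close>. For the partial sums each term is bounded uniformly
  in \<open>k\<close>; the finitely many indices where the upper bound may fail only enlarge the
  constant.\<close>

lemma cond_bI:
  assumes "\<beta> > 0" "\<eta> > 1"
    and lower: "\<forall>\<^sub>F k in sequentially. z_seq \<beta> \<sigma> p k \<ge> 8 * ln (real k)"
    and upper: "\<forall>\<^sub>F k in sequentially. z_seq \<beta> \<sigma> p k \<le> C * ln (real k) powr \<eta>"
  shows "cond_b \<beta> \<sigma> p"
proof -
  let ?z = "z_seq \<beta> \<sigma> p"
  have "summable (\<lambda>k. exp (- ?z k / 4))"
  proof (rule summable_comparison_test_ev)
    show "\<forall>\<^sub>F k in sequentially. norm (exp (- ?z k / 4)) \<le> inverse (real k ^ 2)"
      using lower eventually_gt_at_top[of 0]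
    proof eventually_elim
      case (elim k)
      have "exp (- ?z k / 4) \<le> exp (- (2 * ln (real k)))" using elim by simp
      also have "\<dots> = inverse (real k ^ 2)"
        using elim by (simp add: exp_minus exp_double)
      finally show ?case by simp
    qed
    show "summable (\<lambda>k. inverse (real k ^ 2))" by (intro inverse_power_summable) simp
  qed
  then have summable: "summable (\<lambda>k. exp (- ?z (Suc k) / 4))"
    by (subst summable_Suc_iff)
  obtain K where K: "\<And>k. k \<ge> K \<Longrightarrow> ?z k \<le> C * ln (real k) powr \<eta>"
    using upper by (auto simp: eventually_sequentially)
  define M where "M = (\<Sum>k<K. \<bar>?z k\<bar>)"
  \<comment> \<open>As \<open>ln n \<ge> ln 2\<close>, dividing by \<open>ln 2 powr \<eta>\<close>
    absorbs \<open>M\<close> into the logarithmic factor. The sign of \<open>C\<close> is free,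
    hence the absolute value; the summand 1 forces \<open>D > 0\<close>.\<close>
  define D where "D = M / ln 2 powr \<eta> + \<bar>C\<bar> + 1"
  have "M \<ge> 0" by (simp add: M_def sum_nonneg)
  then have "D > 0" by (simp add: D_def add_nonneg_pos)
  moreover have "(\<Sum>k=1..N_cut \<beta> n. ?z k) \<le> D * (real (N_cut \<beta> n) * ln (real n) powr \<eta>)"
    if n: "n \<ge> 2" for n
  proof -
    have "?z k \<le> D * ln (real n) powr \<eta>" if k: "k \<in> {1..N_cut \<beta> n}" for k
    proof -
      have "k \<le> n" using k N_cut_le[OF assms(1), of n] n by simp
      then have le: "ln (real k) powr \<eta> \<le> ln (real n) powr \<eta>"
        using k assms(2) by (intro powr_mono2) auto
      have "ln 2 powr \<eta> \<le> ln (real n) powr \<eta>"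
        using n assms(2) by (intro powr_mono2) auto
      then have "M / ln 2 powr \<eta> * ln 2 powr \<eta> \<le> M / ln 2 powr \<eta> * ln (real n) powr \<eta>"
        using \<open>M \<ge> 0\<close> by (intro mult_left_mono) auto
      then have M: "M \<le> M / ln 2 powr \<eta> * ln (real n) powr \<eta>" by simp
      have "?z k \<le> M + \<bar>C\<bar> * ln (real k) powr \<eta>"
      proof (cases "k < K")
        case True
        then have "\<bar>?z k\<bar> \<le> M" unfolding M_def by (intro member_le_sum) auto
        moreover have "\<bar>C\<bar> * ln (real k) powr \<eta> \<ge> 0" by simp
        ultimately show ?thesis by linarith
      next
        case False
        then have "?z k \<le> C * ln (real k) powr \<eta>" by (intro K) simp
        also have "\<dots> \<le> \<bar>C\<bar> * ln (real k) powr \<eta>" by (intro mult_right_mono) auto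
        finally show ?thesis using \<open>M \<ge> 0\<close> by linarith
      qed
      also have "\<dots> \<le> M / ln 2 powr \<eta> * ln (real n) powr \<eta> + \<bar>C\<bar> * ln (real n) powr \<eta>"
        using M le by (intro add_mono mult_left_mono) auto
      also have "\<dots> \<le> D * ln (real n) powr \<eta>"
        by (simp add: D_def algebra_simps)
      finally show ?thesis .
    qed
    \<comment> \<open>The bound is the same for all \<open>k\<close>, so the sum costs a factor
      equal to the number of terms, \<open>N_cut \<beta> n\<close>.\<close>
    from sum_bounded_above[of "{1..N_cut \<beta> n}", OF this] show ?thesis by (simp add: algebra_simps)
  qed
  ultimately show ?thesis
    unfolding cond_b_def using summable assms(2) by blast
qed

section \<open>Closed forms of the powers of \<open>r_seq\<close>\<close>

lemma r_powr_p_poly: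
  assumes "k \<ge> 3"
  shows "r_seq \<beta> (sigma_poly \<alpha>) k powr p_poly k = ln (real k) powr (\<alpha> - \<beta>)"
proof -
  have "r_seq \<beta> (sigma_poly \<alpha>) k = real k powr (\<alpha> - \<beta>)"
    using assms by (simp add: r_seq_def sigma_poly_def flip: powr_diff)
  \<comment> \<open>The factor \<open>ln k\<close> in
    \<open>ln r = (\<alpha> - \<beta>) * ln k\<close> cancels the denominator of
    \<open>p_poly k\<close>, leaving \<open>(\<alpha> - \<beta>) * ln (ln k)\<close> in the
    exponent.\<close>
  then show ?thesis
    using assms ln_gt_1[OF assms] by (simp add: p_poly_def powr_powr) (simp add: powr_def)
qed

text \<open>Multiplication by \<open>p_fast\<close> turns the dominant term
  \<open>L powr (1 + \<gamma>)\<close> of \<open>ln r\<close> into the constant \<open>c\<close>,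
  and the term linear in \<open>L = ln k\<close> into a vanishing correction.\<close>

lemma r_powr_p_fast:
  assumes "k \<ge> 3"
  shows "r_seq \<beta> (sigma_fast \<gamma>) k powr p_fast \<gamma> c k
    = exp (c - c * (\<beta> + 1/2) * ln (real k) powr (- \<gamma>))"
proof -
  let ?L = "ln (real k)"
  have L: "?L > 0" using ln_gt_1[OF assms] by simp
  have "real k powr (- \<beta> - 1/2) = exp (- (\<beta> + 1/2) * ?L)"
    using assms by (simp add: powr_def)
  then have "r_seq \<beta> (sigma_fast \<gamma>) k = exp (- (\<beta> + 1/2) * ?L - - (?L powr (1 + \<gamma>)))"
    unfolding r_seq_def sigma_fast_def exp_diff by simp
  then have r: "r_seq \<beta> (sigma_fast \<gamma>) k = exp (?L powr (1 + \<gamma>) - (\<beta> + 1/2) * ?L)"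
    by (simp add: algebra_simps)
  have 1: "?L * ?L powr (- (1 + \<gamma>)) = ?L powr (- \<gamma>)"
    using L by (simp add: powr_mult_base)
  have 2: "?L powr (1 + \<gamma>) * ?L powr (- (1 + \<gamma>)) = 1"
    using L by (simp flip: powr_add)
  \<comment> \<open>Over abstract reals the products come out grouped exactly as in facts
    \<open>1\<close> and \<open>2\<close>.\<close>
  have "(u - b * l) * (c * v) = c * (u * v) - c * b * (l * v)" for u b l v :: real
    by (simp add: algebra_simps)
  from this[of "?L powr (1 + \<gamma>)" "\<beta> + 1/2" ?L "?L powr (- (1 + \<gamma>))"]
  have "(?L powr (1 + \<gamma>) - (\<beta> + 1/2) * ?L) * (c * ?L powr (- (1 + \<gamma>)))
    = c - c * (\<beta> + 1/2) * ?L powr (- \<gamma>)"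
    by (simp only: 1 2 mult_1_right)
  then show ?thesis
    \<comment> \<open>Only the power with base \<open>exp _\<close> is unfolded; powers of
      \<open>ln k\<close> stay intact.\<close>
    using assms by (simp only: r p_fast_def powr_def[of "exp _"] ln_exp) (simp add: mult.commute)
qed

section \<open>Numerical bound for \<open>ln 8\<close>, and the exponents in (o)\<close>

lemma ln_8_less: "ln (8::real) < 2.1"
proof -
  have "ln (8::real) = 3 * ln 2" using ln_realpow[of "2::real" 3] by simp
  \<comment> \<open>Here \<open>3 * 25/36 = 75/36\<close>, which is just below 2.1.\<close>
  with ln2_le_25_over_36 show ?thesis by simp
qed

lemma p_poly_bounds: "0 < p_poly k \<and> p_poly k \<le> 1"
proof (cases "k < 3")
  case False
  then have L: "ln (real k) > 1" by (simp add: ln_gt_1)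
  then have "ln (ln (real k)) \<le> ln (real k)" using ln_le_minus_one[of "ln (real k)"] by linarith
  with L False show ?thesis by (simp add: p_poly_def)
qed (simp add: p_poly_def)

lemma p_fast_pos: "0 < p_fast \<gamma> c k" if "c > 0"
  using that ln_gt_1[of k] by (auto simp: p_fast_def)

lemma eventually_p_fast_le_1:
  assumes "\<gamma> > 0"
  shows "\<forall>\<^sub>F k in sequentially. p_fast \<gamma> c k \<le> 1"
proof -
  have "\<forall>\<^sub>F k in sequentially. c * ln (real k) powr (- (1 + \<gamma>)) \<le> 1"
    using assms by real_asymp
  then show ?thesis by eventually_elim (simp add: p_fast_def)
qed

text \<open>From index 3 on \<open>p_fast\<close> decreases, so the bound by 1 is decided at
  \<open>k = 3\<close>.\<close>

lemma cond_o_p_fast_iff: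
  assumes "\<gamma> > 0" "c > 0"
  shows "cond_o (p_fast \<gamma> c) \<longleftrightarrow> c \<le> ln 3 powr (1 + \<gamma>)"
proof -
  have iff: "p_fast \<gamma> c k \<le> 1 \<longleftrightarrow> c \<le> ln (real k) powr (1 + \<gamma>)" if "k \<ge> 3" for k
    using that ln_gt_1[OF that] unfolding p_fast_def powr_minus by (simp add: field_simps)
  have "p_fast \<gamma> c k \<le> 1" if "c \<le> ln 3 powr (1 + \<gamma>)" for k
  proof (cases "k < 3")
    case False
    then have "ln 3 powr (1 + \<gamma>) \<le> ln (real k) powr (1 + \<gamma>)"
      using assms by (intro powr_mono2) auto
    with that False iff[of k] show ?thesis by simp
  qed (simp add: p_fast_def)
  then show ?thesis
    unfolding cond_o_def using p_fast_pos[OF assms(2)] iff[of 3] by auto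
qed

section \<open>Verification of (a) and (b) for the two families\<close>

lemma poly_cond_a:
  assumes "\<beta> > 0" "\<alpha> > \<beta>"
  shows "cond_a \<beta> (sigma_poly \<alpha>) p_poly"
proof (rule cond_aI[OF assms(1)])
  define \<delta> where "\<delta> = \<alpha> - \<beta>"
  have "\<delta> > 0" using assms by (simp add: \<delta>_def)
  then have "\<forall>\<^sub>F k in sequentially. ln (real k) powr \<delta> \<ge> 8" by real_asymp
  then show "\<forall>\<^sub>F k in sequentially. r_seq \<beta> (sigma_poly \<alpha>) k powr p_poly k \<ge> 8"
    using eventually_ge_at_top[of 3]
    by eventually_elim (simp add: r_powr_p_poly \<delta>_def)
qed

text \<open>With \<open>L = ln k\<close>, \<open>z\<close> is eventually
  \<open>L powr (1 + \<delta>) / ln L\<close>. The division by \<open>ln L\<close> costs less than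
  the gain \<open>L powr \<delta>\<close>, and it only helps the upper bound once
  \<open>ln L \<ge> 1\<close>.\<close>

lemma poly_cond_b:
  assumes "\<beta> > 0" "\<alpha> > \<beta>"
  shows "cond_b \<beta> (sigma_poly \<alpha>) p_poly"
proof -
  define \<delta> where "\<delta> = \<alpha> - \<beta>"
  have \<delta>: "\<delta> > 0" using assms by (simp add: \<delta>_def)
  let ?f = "\<lambda>k. ln (real k) powr \<delta> * ln (real k) / ln (ln (real k))"
  have z: "\<forall>\<^sub>F k in sequentially. z_seq \<beta> (sigma_poly \<alpha>) p_poly k = ?f k"
    using eventually_ge_at_top[of 3]
    \<comment> \<open>\<open>p_poly\<close> is unfolded only in the second call, since the closed
      form of the power must match it folded.\<close>
    by eventually_elim (simp add: z_seq_def r_powr_p_poly \<delta>_def, simp add: p_poly_def)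
  have "\<forall>\<^sub>F k in sequentially. ?f k \<ge> 8 * ln (real k)"
    using \<delta> by real_asymp
  then have lower: "\<forall>\<^sub>F k in sequentially. z_seq \<beta> (sigma_poly \<alpha>) p_poly k \<ge> 8 * ln (real k)"
    using z by eventually_elim simp
  have "\<forall>\<^sub>F k in sequentially. ?f k \<le> 1 * ln (real k) powr (1 + \<delta>)"
    using \<delta> by real_asymp
  then have "\<forall>\<^sub>F k in sequentially.
      z_seq \<beta> (sigma_poly \<alpha>) p_poly k \<le> 1 * ln (real k) powr (1 + \<delta>)"
    using z by eventually_elim simp
  then show ?thesis
    using assms(1) \<delta> lower by (intro cond_bI[where \<eta> = "1 + \<delta>" and C = 1]) auto
qed

text \<open>Stated for any \<open>p\<close> that agrees eventually with \<open>p_fast\<close>, so as to cover the capped sequence.\<close>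

lemma fast_cond_a:
  assumes "\<beta> > 0" "\<gamma> > 0" "c > 2.1"
    and p: "\<forall>\<^sub>F k in sequentially. p k = p_fast \<gamma> c k"
  shows "cond_a \<beta> (sigma_fast \<gamma>) p"
proof (rule cond_aI[OF assms(1)])
  have "((\<lambda>k. exp (c - c * (\<beta> + 1/2) * ln (real k) powr (- \<gamma>))) \<longlongrightarrow> exp c) sequentially"
    using assms by real_asymp
  \<comment> \<open>The limit \<open>exp c\<close> is approached from below, so strictness provides
    the room for the bound 8.\<close>
  moreover have "exp c > 8"
    using ln_8_less assms(3) by (subst ln_less_cancel_iff[symmetric]) auto
  ultimately have "\<forall>\<^sub>F k in sequentially.
      exp (c - c * (\<beta> + 1/2) * ln (real k) powr (- \<gamma>)) > 8"
    by (rule order_tendstoD)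
  then show "\<forall>\<^sub>F k in sequentially. r_seq \<beta> (sigma_fast \<gamma>) k powr p k \<ge> 8"
    using p eventually_ge_at_top[of 3]
    by eventually_elim (simp only: r_powr_p_fast less_imp_le)
qed

lemma fast_cond_b:
  assumes "\<beta> > 0" "\<gamma> > 0" "c > 0"
    and p: "\<forall>\<^sub>F k in sequentially. p k = p_fast \<gamma> c k"
  shows "cond_b \<beta> (sigma_fast \<gamma>) p"
proof -
  let ?f = "\<lambda>k. exp (c - c * (\<beta> + 1/2) * ln (real k) powr (- \<gamma>))
    / (c * ln (real k) powr (- (1 + \<gamma>)))"
  have z: "\<forall>\<^sub>F k in sequentially. z_seq \<beta> (sigma_fast \<gamma>) p k = ?f k"
    using p eventually_ge_at_top[of 3]
    by eventually_elim (simp add: z_seq_def r_powr_p_fast, simp add: p_fast_def)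
  \<comment> \<open>The numerator tends to \<open>exp c > 0\<close>, so the quotient grows like
    \<open>ln k powr (1 + \<gamma>)\<close>, faster than \<open>ln k\<close>.\<close>
  have "\<forall>\<^sub>F k in sequentially. ?f k \<ge> 8 * ln (real k)"
    using assms(1-3) by real_asymp
  then have lower: "\<forall>\<^sub>F k in sequentially. z_seq \<beta> (sigma_fast \<gamma>) p k \<ge> 8 * ln (real k)"
    using z by eventually_elim simp
  have "\<forall>\<^sub>F k in sequentially. z_seq \<beta> (sigma_fast \<gamma>) p k \<le> exp c / c * ln (real k) powr (1 + \<gamma>)"
    using z eventually_ge_at_top[of 3]
  proof eventually_elim
    case (elim k)
    \<comment> \<open>Dropping the nonnegative correction bounds the numerator by
      \<open>exp c\<close>, whence the constant \<open>exp c / c\<close>.\<close>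
    have "c - c * (\<beta> + 1/2) * ln (real k) powr (- \<gamma>) \<le> c"
      using assms(1-3) by simp
    then have "?f k \<le> exp c / (c * ln (real k) powr (- (1 + \<gamma>)))"
      using assms(3) by (intro divide_right_mono) auto
    also have "\<dots> = exp c / c * ln (real k) powr (1 + \<gamma>)"
      unfolding powr_minus by (simp add: field_simps)
    finally show ?case using elim by simp
  qed
  then show ?thesis
    using assms(1-3) lower by (intro cond_bI[where \<eta> = "1 + \<gamma>" and C = "exp c / c"]) auto
qed

theorem corollary1:
  fixes \<beta> :: real
  assumes "\<beta> > 0"
  shows
    "(\<forall>\<alpha>>\<beta>.
        pos_seqs (sigma_poly \<alpha>) p_poly \<and>
        cond_o p_poly \<and>
        cond_a \<beta> (sigma_poly \<alpha>) p_poly \<and>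
        cond_b \<beta> (sigma_poly \<alpha>) p_poly) \<and>
     (2.1 :: real) > ln 8 \<and>
     (\<forall>\<gamma>>0. \<forall>c>2.1.
        pos_seqs (sigma_fast \<gamma>) (p_fast \<gamma> c) \<and>
        (\<forall>\<^sub>F k in sequentially. p_fast \<gamma> c k \<le> 1) \<and>
        (cond_o (p_fast \<gamma> c) \<longleftrightarrow> c \<le> ln 3 powr (1 + \<gamma>)) \<and>
        cond_a \<beta> (sigma_fast \<gamma>) (p_fast \<gamma> c) \<and>
        cond_b \<beta> (sigma_fast \<gamma>) (p_fast \<gamma> c) \<and>
        cond_o (p_fast_capped \<gamma> c) \<and>
        cond_a \<beta> (sigma_fast \<gamma>) (p_fast_capped \<gamma> c) \<and>
        cond_b \<beta> (sigma_fast \<gamma>) (p_fast_capped \<gamma> c))"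
proof (intro conjI allI impI)
  fix \<alpha> assume \<alpha>: "\<beta> < \<alpha>"
  show "pos_seqs (sigma_poly \<alpha>) p_poly"
    using p_poly_bounds by (simp add: pos_seqs_def sigma_poly_def)
  show "cond_o p_poly"
    using p_poly_bounds by (simp add: cond_o_def)
  show "cond_a \<beta> (sigma_poly \<alpha>) p_poly" "cond_b \<beta> (sigma_poly \<alpha>) p_poly"
    using assms \<alpha> by (rule poly_cond_a poly_cond_b)+
next
  show "ln 8 < (2.1 :: real)" by (rule ln_8_less)
next
  fix \<gamma> c :: real assume \<gamma>: "0 < \<gamma>" and c: "2.1 < c"
  have c0: "c > 0" using c by simp
  show le_1: "\<forall>\<^sub>F k in sequentially. p_fast \<gamma> c k \<le> 1"
    by (rule eventually_p_fast_le_1[OF \<gamma>])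
  \<comment> \<open>Eventual agreement carries (a) and (b) over to the capped sequence.\<close>
  have capped: "\<forall>\<^sub>F k in sequentially. p_fast_capped \<gamma> c k = p_fast \<gamma> c k"
    using le_1 by eventually_elim (simp add: p_fast_capped_def)
  show "pos_seqs (sigma_fast \<gamma>) (p_fast \<gamma> c)"
    using p_fast_pos[OF c0] by (simp add: pos_seqs_def sigma_fast_def)
  show "cond_o (p_fast \<gamma> c) \<longleftrightarrow> c \<le> ln 3 powr (1 + \<gamma>)"
    by (rule cond_o_p_fast_iff[OF \<gamma> c0])
  show "cond_o (p_fast_capped \<gamma> c)"
    using p_fast_pos[OF c0] by (simp add: cond_o_def p_fast_capped_def)
  show "cond_a \<beta> (sigma_fast \<gamma>) (p_fast \<gamma> c)"
    using assms \<gamma> c by (rule fast_cond_a) simp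
  show "cond_b \<beta> (sigma_fast \<gamma>) (p_fast \<gamma> c)"
    using assms \<gamma> c0 by (rule fast_cond_b) simp
  show "cond_a \<beta> (sigma_fast \<gamma>) (p_fast_capped \<gamma> c)"
    using assms \<gamma> c capped by (rule fast_cond_a)
  show "cond_b \<beta> (sigma_fast \<gamma>) (p_fast_capped \<gamma> c)"
    using assms \<gamma> c0 capped by (rule fast_cond_b)
qed

end
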